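(* Let $G$ be a finite simple graph with $\gamma(G)=k$ and let $\overline{G}$ be its complement. Then: (i) if there exists a $k$-witness of $G$ that is both left-free and right-free, then $\gamma(\overline{G})=k-1$; (ii) otherwise, if there exists a $k$-witness of $G$ that is free, then $\gamma(\overline{G})\le k$; (iii) otherwise, if no $k$-witness of $G$ is free, then $\gamma(\overline{G})\le k+1$.
   Context: All graphs are finite, simple and undirected. A graph $G=(V,E)$ is a star-$k$-PCG if there exist a weight function $w:V\to\mathbb{R}^+$ and $k$ pairwise disjoint intervals $I_1,\dots,I_k$ such that for distinct $u,v\in V$, $uv\in E$ if and only if $w(u)+w(v)\in\bigcup_i I_i$; the weighted graph $G^w$ with these intervals is a $k$-witness. Intervals are $I_i=[a_i,b_i]$ with $b_i<a_{i+1}$. The star number $\gamma(G)$ is the least positive $k$ such that $G$ is a star-$k$-PCG. For distinct $u,v$, $w(uv)=w(u)+w(v)$. For $\gamma(G)=k$, a $k$-witness is left-free if every non-edge $e$ satisfies $w(e)>b_1$, right-free if every non-edge $e$ satisfies $w(e)<a_k$, and free if it is left-free or right-free.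
   Formalization: Part (i) is stated for k ≥ 2 only: for k = 1 a witness that is both left-free and right-free exists exactly for complete graphs, whose edgeless complement has star number 1 (the least positive k), not k − 1 = 0. *)

theory Defs
  imports Complex_Main
begin

definition all_pairs :: "'a set \<Rightarrow> 'a set set" where
  "all_pairs V = {{u, v} | u v. u \<in> V \<and> v \<in> V \<and> u \<noteq> v}"

definition simple_graph :: "'a set \<Rightarrow> 'a set set \<Rightarrow> bool" where
  "simple_graph V E \<longleftrightarrow> finite V \<and> E \<subseteq> all_pairs V"

definition complement :: "'a set \<Rightarrow> 'a set set \<Rightarrow> 'a set set" where
  "complement V E = all_pairs V - E"

(* The intervals are {a i..b i} for i = 1, ..., k; values of a and b at other indices, and of w
   outside V, are irrelevant. *)
definition star_witness ::
  "'a set \<Rightarrow> 'a set set \<Rightarrow> nat \<Rightarrow> ('a \<Rightarrow> real) \<Rightarrow> (nat \<Rightarrow> real) \<Rightarrow> (nat \<Rightarrow> real) \<Rightarrow> bool" where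
  "star_witness V E k w a b \<longleftrightarrow>
     (\<forall>v\<in>V. w v > 0) \<and>
     (\<forall>i\<in>{1..k}. a i \<le> b i) \<and>
     (\<forall>i\<in>{1..<k}. b i < a (i + 1)) \<and>
     (\<forall>u\<in>V. \<forall>v\<in>V. u \<noteq> v \<longrightarrow> ({u, v} \<in> E \<longleftrightarrow> w u + w v \<in> (\<Union>i\<in>{1..k}. {a i..b i})))"

definition star_PCG :: "nat \<Rightarrow> 'a set \<Rightarrow> 'a set set \<Rightarrow> bool" where
  "star_PCG k V E \<longleftrightarrow> (\<exists>w a b. star_witness V E k w a b)"

definition star_number :: "'a set \<Rightarrow> 'a set set \<Rightarrow> nat" where
  "star_number V E = (LEAST k. k > 0 \<and> star_PCG k V E)"

definition left_free :: "'a set \<Rightarrow> 'a set set \<Rightarrow> ('a \<Rightarrow> real) \<Rightarrow> (nat \<Rightarrow> real) \<Rightarrow> bool" where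
  "left_free V E w b \<longleftrightarrow>
     (\<forall>u\<in>V. \<forall>v\<in>V. u \<noteq> v \<and> {u, v} \<notin> E \<longrightarrow> w u + w v > b 1)"

definition right_free :: "'a set \<Rightarrow> 'a set set \<Rightarrow> nat \<Rightarrow> ('a \<Rightarrow> real) \<Rightarrow> (nat \<Rightarrow> real) \<Rightarrow> bool" where
  "right_free V E k w a \<longleftrightarrow>
     (\<forall>u\<in>V. \<forall>v\<in>V. u \<noteq> v \<and> {u, v} \<notin> E \<longrightarrow> w u + w v < a k)"

definition free_witness ::
  "'a set \<Rightarrow> 'a set set \<Rightarrow> nat \<Rightarrow> ('a \<Rightarrow> real) \<Rightarrow> (nat \<Rightarrow> real) \<Rightarrow> (nat \<Rightarrow> real) \<Rightarrow> bool" where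
  "free_witness V E k w a b \<longleftrightarrow> left_free V E w b \<or> right_free V E k w a"

(* Since the star number is positive by definition, "a witness that is left-free and right-free
   implies star number k - 1 for the complement" fails for k = 1: then the graph is complete, and
   its edgeless complement has star number 1. Hence that claim needs 2 \<le> k. *)
lemma star_number_complete_graph:
  fixes V :: "'a set" assumes "finite V"
  shows "simple_graph V (all_pairs V) \<and> star_number V (all_pairs V) = 1
    \<and> (\<exists>w a b. star_witness V (all_pairs V) 1 w a b \<and> left_free V (all_pairs V) w b
          \<and> right_free V (all_pairs V) 1 w a)
    \<and> star_number V (complement V (all_pairs V)) = 1"
proof -
  have in_all: "{u,v} \<in> all_pairs V" if "u \<in> V" "v \<in> V" "u \<noteq> v" for u v
    using that unfolding all_pairs_def by blast
  have w: "star_witness V (all_pairs V) 1 (\<lambda>_. 1) (\<lambda>_. 2) (\<lambda>_. 2)"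
    unfolding star_witness_def using in_all by auto
  have w2: "star_witness V (complement V (all_pairs V)) 1 (\<lambda>_. 1) (\<lambda>_. 3) (\<lambda>_. 3)"
    unfolding star_witness_def complement_def by auto
  have L: "left_free V (all_pairs V) (\<lambda>_. 1) (\<lambda>_. 2)" "right_free V (all_pairs V) 1 (\<lambda>_. 1) (\<lambda>_. 2)"
    unfolding left_free_def right_free_def using in_all by auto
  have "star_number V (all_pairs V) = 1" "star_number V (complement V (all_pairs V)) = 1"
    unfolding star_number_def star_PCG_def
    by (rule Least_equality; use w w2 in force)+
  thus ?thesis using w L assms unfolding simple_graph_def by blast
qed

end

theory Submission
  imports Defs
begin

text \<open>
  The non-edges of a \<open>k\<close>-witness have their weights in the \<open>k + 1\<close> gaps left by the intervals (the
  two outer gaps being unbounded). As there are finitely many weights, each gap can be shrunk to a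
  compact interval containing the same weights, so the same vertex weights witness that the
  complement is a star-\<open>(k + 1)\<close>-PCG. A left-free (right-free) witness has no non-edge in the first
  (last) gap, which can then be dropped. Applying the bound \<open>k + 1\<close> to the complement
  gives the lower bound in case (i). That the star number is attained at all follows from
  the weights \<open>2 ^ i\<close>, for which distinct pairs of vertices have distinct weights.
\<close>

section \<open>Pairs, complements and the shrinking of open intervals\<close>

lemma all_pairs_doubleton_iff:
  "u \<noteq> v \<Longrightarrow> {u, v} \<in> all_pairs V \<longleftrightarrow> u \<in> V \<and> v \<in> V"
  unfolding all_pairs_def by (auto simp: doubleton_eq_iff)

lemma complement_complement: "E \<subseteq> all_pairs V \<Longrightarrow> complement V (complement V E) = E"
  unfolding complement_def by blast

lemma compact_subinterval_same_points:
  fixes p q :: real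
  assumes "finite S" "p < q"
  shows "\<exists>c d. p < c \<and> c \<le> d \<and> d < q \<and> (\<forall>s\<in>S. p < s \<and> s < q \<longleftrightarrow> c \<le> s \<and> s \<le> d)"
proof -
  \<comment> \<open>The midpoint is added so that \<open>T\<close> is nonempty even when no point of
    \<open>S\<close> lies between \<open>p\<close> and \<open>q\<close>; the compact interval then
    runs from \<open>Min T\<close> to \<open>Max T\<close>.\<close>
  define T where "T = insert ((p + q) / 2) {s\<in>S. p < s \<and> s < q}"
  have T: "finite T" "T \<noteq> {}" "\<And>t. t \<in> T \<Longrightarrow> p < t \<and> t < q"
    using assms by (auto simp: T_def field_simps)
  have "Min T \<in> T" "Max T \<in> T" using T by auto
  then have "p < Min T" "Min T \<le> Max T" "Max T < q" using T by auto
  moreover have "p < s \<and> s < q \<longleftrightarrow> Min T \<le> s \<and> s \<le> Max T" if "s \<in> S" for s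
  proof
    assume "p < s \<and> s < q"
    then have "s \<in> T" using that by (simp add: T_def)
    then show "Min T \<le> s \<and> s \<le> Max T" using T by simp
  next
    assume "Min T \<le> s \<and> s \<le> Max T"
    then show "p < s \<and> s < q" using calculation by linarith
  qed
  ultimately show ?thesis by blast
qed

text \<open>Shrinking each open interval around the finitely many sums leaves room at both ends, so
  even open intervals that share an endpoint become strictly separated.\<close>

lemma star_PCG_if_open_intervals:
  fixes p q :: "nat \<Rightarrow> real"
  assumes "finite V" and pos: "\<forall>v\<in>V. w v > 0"
    and pq: "\<forall>i\<in>{1..m}. p i < q i" and chain: "\<forall>i\<in>{1..<m}. q i \<le> p (i + 1)"
    and edge: "\<forall>u\<in>V. \<forall>v\<in>V. u \<noteq> v \<longrightarrow>
      ({u, v} \<in> E \<longleftrightarrow> (\<exists>i\<in>{1..m}. p i < w u + w v \<and> w u + w v < q i))"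
  shows "star_PCG m V E"
proof -
  define S where "S = (\<lambda>(u, v). w u + w v) ` (V \<times> V)"
  have "finite S" using assms(1) by (simp add: S_def)
  then have "\<forall>i\<in>{1..m}. \<exists>c d. p i < c \<and> c \<le> d \<and> d < q i \<and>
      (\<forall>s\<in>S. p i < s \<and> s < q i \<longleftrightarrow> c \<le> s \<and> s \<le> d)"
    using pq compact_subinterval_same_points by blast
  then obtain c d where cd: "\<And>i. i \<in> {1..m} \<Longrightarrow> p i < c i \<and> c i \<le> d i \<and> d i < q i \<and>
      (\<forall>s\<in>S. p i < s \<and> s < q i \<longleftrightarrow> c i \<le> s \<and> s \<le> d i)"
    by metis
  have "d i < c (i + 1)" if "i \<in> {1..<m}" for i
  proof -
    have "d i < q i" "q i \<le> p (i + 1)" "p (i + 1) < c (i + 1)"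
      using cd[of i] cd[of "i + 1"] chain that by auto
    then show ?thesis by linarith
  qed
  moreover have "{u, v} \<in> E \<longleftrightarrow> w u + w v \<in> (\<Union>i\<in>{1..m}. {c i..d i})"
    if "u \<in> V" "v \<in> V" "u \<noteq> v" for u v
  proof -
    have "w u + w v \<in> S" using that by (auto simp: S_def)
    then show ?thesis using edge that cd by (simp add: Bex_def) blast
  qed
  ultimately have "star_witness V E m w c d"
    using pos cd unfolding star_witness_def by blast
  then show ?thesis unfolding star_PCG_def by blast
qed

section \<open>Gaps in a chain of intervals, with \<open>b 0\<close> and \<open>a (k + 1)\<close> as
  artificial outer ends\<close>

lemma chain_endpoints_less:
  fixes a b :: "nat \<Rightarrow> real"
  assumes "\<forall>i\<in>{1..k}. a i \<le> b i" "\<forall>i\<in>{0..k}. b i < a (i + 1)"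
    and "i < j" "j \<le> k + 1"
  shows "b i < a j"
  using assms(3,4)
proof (induction j)
  case (Suc j)
  show ?case
  proof (cases "i = j")
    case True
    then show ?thesis using assms(2) Suc.prems by auto
  next
    case False
    then have "b i < a j" using Suc by simp
    also have "a j \<le> b j" using assms(1) Suc.prems False by auto
    also have "b j < a (Suc j)" using assms(2) Suc.prems by auto
    finally show ?thesis .
  qed
qed simp

lemma not_in_intervals_iff_in_gap:
  fixes a b :: "nat \<Rightarrow> real"
  assumes ab: "\<forall>i\<in>{1..k}. a i \<le> b i" and ba: "\<forall>i\<in>{0..k}. b i < a (i + 1)"
    and s: "b 0 < s" "s < a (k + 1)"
  shows "s \<notin> (\<Union>i\<in>{1..k}. {a i..b i}) \<longleftrightarrow> (\<exists>i\<in>{0..k}. b i < s \<and> s < a (i + 1))"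
proof
  assume out: "s \<notin> (\<Union>i\<in>{1..k}. {a i..b i})"
  \<comment> \<open>This picks the gap: if \<open>n > 0\<close>, minimality gives
    \<open>a n \<le> s\<close>, and since \<open>s\<close> avoids interval \<open>n\<close>, it
    exceeds \<open>b n\<close>.\<close>
  define n where "n = (LEAST n. s < a (n + 1))"
  have n: "s < a (n + 1)" "n \<le> k"
    unfolding n_def using s(2) by (auto intro: LeastI Least_le)
  have "b n < s"
  proof (cases n)
    case 0
    then show ?thesis using s by simp
  next
    case (Suc m)
    then have "\<not> s < a (m + 1)" unfolding n_def by (metis not_less_Least lessI)
    moreover have "n \<in> {1..k}" using n Suc by simp
    ultimately show ?thesis using out Suc by fastforce
  qed
  then show "\<exists>i\<in>{0..k}. b i < s \<and> s < a (i + 1)" using n by auto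
next
  assume "\<exists>i\<in>{0..k}. b i < s \<and> s < a (i + 1)"
  then obtain i where i: "i \<le> k" "b i < s" "s < a (i + 1)" by auto
  show "s \<notin> (\<Union>i\<in>{1..k}. {a i..b i})"
  proof
    assume "s \<in> (\<Union>i\<in>{1..k}. {a i..b i})"
    then obtain j where j: "1 \<le> j" "j \<le> k" "a j \<le> s" "s \<le> b j" by auto
    \<comment> \<open>Interval \<open>j\<close> ends no later than \<open>b i\<close>, is the one
      that closes the gap, or starts beyond it; each contradicts that \<open>s\<close> lies in
      both.\<close>
    consider "j < i + 1" | "i + 1 = j" | "i + 1 < j" by linarith
    then show False
    proof cases
      case 1
      then have "j = i \<or> b j < a i" using chain_endpoints_less[OF ab ba, of j i] i by linarith
      moreover have "a i \<le> b i" using ab i j 1 by auto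
      ultimately show False using i j by auto
    next
      case 2
      then show False using i j by simp
    next
      case 3
      then have "b (i + 1) < a j" using chain_endpoints_less[OF ab ba] j by simp
      moreover have "a (i + 1) \<le> b (i + 1)" using ab 3 j by auto
      ultimately show False using i j by linarith
    qed
  qed
qed

section \<open>From a witness of the graph to one of its complement\<close>

text \<open>The parameters \<open>l\<close> and \<open>r\<close> count the outer gaps dropped on the left and on the right.\<close>

lemma star_PCG_complement:
  assumes "finite V" "0 < k" and wit: "star_witness V E k w a b"
    and l: "l = 0 \<or> l = 1 \<and> left_free V E w b"
    and r: "r = 0 \<or> r = 1 \<and> right_free V E k w a"
    and m: "m + l + r = k + 1"
  shows "star_PCG m V (complement V E)"
proof -
  define S where "S = (\<lambda>(u, v). w u + w v) ` (V \<times> V)"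
  have fin: "finite S" using assms(1) by (simp add: S_def)
  \<comment> \<open>\<open>L\<close> and \<open>R\<close> lie strictly beyond all sums and all
    intervals. Stored at the free indices \<open>0\<close> and \<open>k + 1\<close>, they make the
    two outer gaps bounded.\<close>
  define L where "L = Min (insert (a 1) S) - 1"
  define R where "R = Max (insert (b k) S) + 1"
  define a' where "a' = a(k + 1 := R)"
  define b' where "b' = b(0 := L)"
  have L: "L < a 1" "\<And>s. s \<in> S \<Longrightarrow> L < s"
  proof -
    have "L + 1 \<le> s" if "s \<in> insert (a 1) S" for s
      using fin that by (simp add: L_def del: Min_insert)
    then show "L < a 1" "\<And>s. s \<in> S \<Longrightarrow> L < s" by fastforce+
  qed
  have R: "b k < R" "\<And>s. s \<in> S \<Longrightarrow> s < R"
  proof -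
    have "s \<le> R - 1" if "s \<in> insert (b k) S" for s
      using fin that by (simp add: R_def del: Max_insert)
    then show "b k < R" "\<And>s. s \<in> S \<Longrightarrow> s < R" by fastforce+
  qed
  have ab: "\<forall>i\<in>{1..k}. a i \<le> b i" and ba: "\<forall>i\<in>{1..<k}. b i < a (i + 1)"
    and pos: "\<forall>v\<in>V. w v > 0"
    and edge: "\<And>u v. u \<in> V \<Longrightarrow> v \<in> V \<Longrightarrow> u \<noteq> v \<Longrightarrow>
      {u, v} \<in> E \<longleftrightarrow> w u + w v \<in> (\<Union>i\<in>{1..k}. {a i..b i})"
    using wit unfolding star_witness_def by blast+
  have ab': "\<forall>i\<in>{1..k}. a' i \<le> b' i" using ab by (simp add: a'_def b'_def)
  have ba': "\<forall>i\<in>{0..k}. b' i < a' (i + 1)"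
  proof
    fix i assume "i \<in> {0..k}"
    then consider "i = 0" | "i = k" "i \<noteq> 0" | "i \<in> {1..<k}" by fastforce
    then show "b' i < a' (i + 1)"
      using L(1) R(1) ba \<open>0 < k\<close> by cases (auto simp: a'_def b'_def)
  qed
  have U: "(\<Union>i\<in>{1..k}. {a' i..b' i}) = (\<Union>i\<in>{1..k}. {a i..b i})"
    by (simp add: a'_def b'_def)
  \<comment> \<open>The gaps, numbered from 0, run from \<open>b' j\<close> to
    \<open>a' (j + 1)\<close>. The new interval \<open>i\<close> uses gap \<open>i + l - 1\<close>,
    so \<open>l = 1\<close> skips gap 0; the subtraction is exact as
    \<open>i \<ge> 1\<close>.\<close>
  define p where "p i = b' (i + l - 1)" for i
  define q where "q i = a' (i + l)" for i
  show ?thesis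
  proof (rule star_PCG_if_open_intervals[where w = w and p = p and q = q])
    show "finite V" "\<forall>v\<in>V. w v > 0" by fact+
    show "\<forall>i\<in>{1..m}. p i < q i"
    proof
      fix i assume "i \<in> {1..m}"
      then have "i + l - 1 \<in> {0..k}" "i + l - 1 + 1 = i + l" using m by auto
      then show "p i < q i" using ba' unfolding p_def q_def by metis
    qed
    show "\<forall>i\<in>{1..<m}. q i \<le> p (i + 1)"
    proof
      fix i assume "i \<in> {1..<m}"
      then have "i + l \<in> {1..k}" using m by auto
      then show "q i \<le> p (i + 1)" using ab' by (simp add: p_def q_def)
    qed
    show "\<forall>u\<in>V. \<forall>v\<in>V. u \<noteq> v \<longrightarrow> ({u, v} \<in> complement V E \<longleftrightarrow>
      (\<exists>i\<in>{1..m}. p i < w u + w v \<and> w u + w v < q i))"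
    proof (intro ballI impI)
      fix u v assume uv: "u \<in> V" "v \<in> V" "u \<noteq> v"
      define s where "s = w u + w v"
      have "s \<in> S" using uv by (auto simp: S_def s_def)
      then have "b' 0 < s" "s < a' (k + 1)" using L R by (simp_all add: a'_def b'_def)
      from not_in_intervals_iff_in_gap[OF ab' ba' this]
      have gap: "{u, v} \<notin> E \<longleftrightarrow> (\<exists>i\<in>{0..k}. b' i < s \<and> s < a' (i + 1))"
        using edge[OF uv] unfolding U s_def by blast
      have compl: "{u, v} \<in> complement V E \<longleftrightarrow> {u, v} \<notin> E"
        using uv by (simp add: complement_def all_pairs_doubleton_iff)
      show "{u, v} \<in> complement V E \<longleftrightarrow> (\<exists>i\<in>{1..m}. p i < w u + w v \<and> w u + w v < q i)"
        unfolding compl s_def[symmetric]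
      proof
        assume nE: "{u, v} \<notin> E"
        then obtain i where i: "i \<le> k" "b' i < s" "s < a' (i + 1)" using gap by auto
        \<comment> \<open>This can fail only for \<open>l = 1\<close> and \<open>i = 0\<close>:
          left-freeness puts \<open>s\<close> above \<open>b 1\<close>, whereas gap 0 ends at
          \<open>a 1\<close>. The last gap is excluded symmetrically.\<close>
        have "l \<le> i"
        proof (rule ccontr)
          assume "\<not> l \<le> i"
          then have "i = 0" "left_free V E w b" using l by auto
          then have "b 1 < s" "s < a 1"
            using i nE uv \<open>0 < k\<close> by (auto simp: left_free_def s_def a'_def)
          then show False using ab \<open>0 < k\<close> by force
        qed
        moreover have "i + r \<le> k"
        proof (rule ccontr)
          assume "\<not> i + r \<le> k"
          then have "i = k" "right_free V E k w a" using r i by auto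
          then have "s < a k" "b k < s"
            using i nE uv \<open>0 < k\<close> by (auto simp: right_free_def s_def b'_def)
          moreover have "a k \<le> b k" using ab \<open>0 < k\<close> by simp
          ultimately show False by linarith
        qed
        ultimately have "i + 1 - l \<in> {1..m}" "i + 1 - l + l - 1 = i" "i + 1 - l + l = i + 1"
          using m by auto
        then show "\<exists>i\<in>{1..m}. p i < s \<and> s < q i"
          using i unfolding p_def q_def by metis
      next
        assume "\<exists>i\<in>{1..m}. p i < s \<and> s < q i"
        then obtain i where i: "i \<in> {1..m}" "p i < s" "s < q i" by blast
        then have "i + l - 1 \<in> {0..k}" "i + l - 1 + 1 = i + l" using m by auto
        then show "{u, v} \<notin> E" using gap i unfolding p_def q_def by metis
      qed
    qed
  qed
qed

lemma star_PCG_complement_Suc: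
  assumes "finite V" "0 < k" "star_PCG k V E"
  shows "star_PCG (k + 1) V (complement V E)"
  using assms star_PCG_complement[of V k E _ _ _ 0 0 "k + 1"] unfolding star_PCG_def[of k] by auto

section \<open>Every finite graph has a witness\<close>

text \<open>The larger exponent is determined by the sum: \<open>2 ^ i + 2 ^ j\<close> stays below
  \<open>2 ^ (j + 1)\<close> when \<open>i < j\<close>.\<close>

lemma sum_two_powers_of_2_le:
  fixes i j i' j' :: nat
  assumes "i < j" "i' < j'" "(2::nat) ^ i + 2 ^ j = 2 ^ i' + 2 ^ j'"
  shows "j' \<le> j"
proof (rule ccontr)
  assume "\<not> j' \<le> j"
  then have "(2::nat) ^ Suc j \<le> 2 ^ j'" by (intro power_increasing) auto
  moreover have "(2::nat) ^ i < 2 ^ j" using assms(1) by simp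
  ultimately show False using assms(3) by simp
qed

lemma sum_two_powers_of_2_inj:
  fixes i j i' j' :: nat
  assumes "i \<noteq> j" "i' \<noteq> j'" and eq: "(2::nat) ^ i + 2 ^ j = 2 ^ i' + 2 ^ j'"
  shows "{i, j} = {i', j'}"
proof -
  have ordered: "i = i' \<and> j = j'"
    if "i < j" "i' < j'" "(2::nat) ^ i + 2 ^ j = 2 ^ i' + 2 ^ j'" for i j i' j' :: nat
  proof -
    have "j = j'" using sum_two_powers_of_2_le that by (metis order_antisym)
    then show ?thesis using that(3) by simp
  qed
  \<comment> \<open>Passing to minimum and maximum reduces unordered pairs to the ordered
    case.\<close>
  have "{i, j} = {min i j, max i j}" "{i', j'} = {min i' j', max i' j'}"
    by (auto simp: min_def max_def)
  moreover have "min i j = min i' j' \<and> max i j = max i' j'"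
    using assms by (intro ordered) (auto simp: min_def max_def)
  ultimately show ?thesis by simp
qed

text \<open>With weights that separate all pairs, each edge weight can be given its own one-point
  interval.\<close>

lemma star_PCG_exists:
  assumes "finite V"
  shows "\<exists>k>0. star_PCG k V E"
proof -
  obtain f :: "'a \<Rightarrow> nat" where f: "inj_on f V"
    using finite_imp_inj_to_nat_seg[OF assms] by blast
  define w :: "'a \<Rightarrow> real" where "w v = 2 ^ f v" for v
  \<comment> \<open>The extra value 0 keeps the number of intervals positive for an edgeless graph;
    it is never a sum of two positive weights.\<close>
  define S where "S = insert 0 {w u + w v | u v. u \<in> V \<and> v \<in> V \<and> u \<noteq> v \<and> {u, v} \<in> E}"
  have "S \<subseteq> insert 0 ((\<lambda>(u, v). w u + w v) ` (V \<times> V))" unfolding S_def by auto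
  then have fin: "finite S" using assms by (meson finite.insertI finite_SigmaI finite_imageI finite_subset)
  define xs where "xs = sorted_list_of_set S"
  have xs: "set xs = S" "sorted_wrt (<) xs"
    using fin by (auto simp: xs_def)
  \<comment> \<open>Intervals are numbered from 1, list positions from 0.\<close>
  define c where "c i = xs ! (i - 1)" for i
  have U: "(\<Union>i\<in>{1..length xs}. {c i..c i}) = S"
  proof -
    have "(\<Union>i\<in>{1..length xs}. {c i..c i}) = (\<lambda>i. xs ! (i - 1)) ` Suc ` {0..<length xs}"
      by (auto simp: c_def image_Suc_atLeastLessThan atLeastLessThanSuc_atLeastAtMost)
    also have "\<dots> = (!) xs ` {0..<length xs}" unfolding image_image by simp
    also have "\<dots> = S" using xs(1) nth_image[of "length xs" xs] by simp
    finally show ?thesis .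
  qed
  have edge: "{u, v} \<in> E \<longleftrightarrow> w u + w v \<in> S" if uv: "u \<in> V" "v \<in> V" "u \<noteq> v" for u v
  proof
    assume "w u + w v \<in> S"
    moreover have "w u + w v > 0" by (simp add: w_def add_pos_pos)
    ultimately obtain x y where xy: "x \<in> V" "y \<in> V" "x \<noteq> y" "{x, y} \<in> E"
      "w u + w v = w x + w y"
      unfolding S_def by auto
    have "real (2 ^ f u + 2 ^ f v) = real (2 ^ f x + 2 ^ f y)" using xy(5) by (simp add: w_def)
    then have "2 ^ f u + 2 ^ f v = (2 ^ f x + 2 ^ f y :: nat)" by (simp only: of_nat_eq_iff)
    then have "f ` {u, v} = f ` {x, y}"
      using sum_two_powers_of_2_inj f uv xy by (simp add: inj_on_eq_iff)
    then have "{u, v} = {x, y}" using f uv xy by (subst (asm) inj_on_image_eq_iff) auto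
    then show "{u, v} \<in> E" using xy by simp
  qed (use uv in \<open>auto simp: S_def\<close>)
  have "c i < c (i + 1)" if "i \<in> {1..<length xs}" for i
    using sorted_wrt_nth_less[OF xs(2)] that by (simp add: c_def)
  then have "star_witness V E (length xs) w c c"
    using edge U unfolding star_witness_def by (simp add: w_def)
  moreover have "length xs > 0" using xs(1) by (auto simp: S_def)
  ultimately show ?thesis unfolding star_PCG_def by blast
qed

section \<open>Bounds on the star number of the complement\<close>

lemma star_number_attained:
  assumes "finite V"
  shows "star_number V E > 0" "star_PCG (star_number V E) V E"
  using LeastI_ex[OF star_PCG_exists[OF assms, of E]] unfolding star_number_def by auto

lemma star_number_le: "0 < k \<Longrightarrow> star_PCG k V E \<Longrightarrow> star_number V E \<le> k"
  unfolding star_number_def by (rule Least_le) simp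

theorem theorem6:
  fixes V :: "'a set" and E :: "'a set set" and k :: nat
  assumes "simple_graph V E"
    and "star_number V E = k"
  shows "(2 \<le> k \<and>
          (\<exists>w a b. star_witness V E k w a b \<and> left_free V E w b \<and> right_free V E k w a)
          \<longrightarrow> star_number V (complement V E) = k - 1) \<and>
         (\<not> (\<exists>w a b. star_witness V E k w a b \<and> left_free V E w b \<and> right_free V E k w a) \<and>
          (\<exists>w a b. star_witness V E k w a b \<and> free_witness V E k w a b)
          \<longrightarrow> star_number V (complement V E) \<le> k) \<and>
         (\<not> (\<exists>w a b. star_witness V E k w a b \<and> free_witness V E k w a b)
          \<longrightarrow> star_number V (complement V E) \<le> k + 1)"
proof -
  have fin: "finite V" and E: "E \<subseteq> all_pairs V" using assms(1) by (auto simp: simple_graph_def)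
  have k: "0 < k" "star_PCG k V E" using star_number_attained[OF fin, of E] assms(2) by auto
  have upper: "star_number V (complement V E) \<le> k + 1"
    using star_PCG_complement_Suc[OF fin k] by (intro star_number_le) simp_all
  \<comment> \<open>The general bound is applied to the complement, whose own complement is
    \<open>E\<close> again.\<close>
  have lower: "k \<le> star_number V (complement V E) + 1"
    using star_PCG_complement_Suc[OF fin star_number_attained[OF fin]]
    by (metis E assms(2) complement_complement star_number_le add_gr_0 zero_less_one)
  have both: "star_number V (complement V E) = k - 1"
    if "2 \<le> k" "star_witness V E k w a b" "left_free V E w b" "right_free V E k w a" for w a b
  proof -
    have "star_PCG (k - 1) V (complement V E)"
      \<comment> \<open>Both outer gaps are dropped, leaving \<open>k - 1\<close> of the
        \<open>k + 1\<close> gaps; \<open>2 \<le> k\<close> makes this number positive.\<close>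
      using star_PCG_complement[OF fin k(1) that(2), of 1 1 "k - 1"] that by simp
    then have "star_number V (complement V E) \<le> k - 1" using that(1) by (intro star_number_le) auto
    then show ?thesis using lower by simp
  qed
  have one: "star_number V (complement V E) \<le> k"
    if "star_witness V E k w a b" "free_witness V E k w a b" for w a b
  proof (rule star_number_le[OF k(1)])
    show "star_PCG k V (complement V E)"
      using that(2) star_PCG_complement[OF fin k(1) that(1), of 1 0 k]
        star_PCG_complement[OF fin k(1) that(1), of 0 1 k]
      by (auto simp: free_witness_def)
  qed
  show ?thesis using both one upper by blast
qed

end
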